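(* Let $2\le d\le n-1$. Among all trees on $n$ vertices with diameter $d$, $C_{n,d,\lfloor d/2\rfloor}$ is the unique tree having maximal Harary index.
   Context: The Harary index of a connected graph $G$ is $H(G)=\sum_{\{x,y\}\subseteq V(G),\,x\ne y}\frac{1}{d(x,y)}$, $d(x,y)$ the shortest-path distance; the diameter is the maximum distance between two vertices. For $1\le i\le d-1$, $C_{n,d,i}$ is the caterpillar on $n$ vertices obtained from a path $v_0v_1\dots v_d$ by attaching $n-d-1$ pendent vertices to $v_i$. *)

theory Defs
  imports "Graph_Theory.Graph_Theory"
begin

text \<open>A finite simple graph is a \<^locale>\<open>pair_graph\<close>: a loop-free symmetric digraph on a finite
  vertex set, every edge being represented by its two opposite arcs.\<close>

definition gdist :: "'a pair_pre_digraph \<Rightarrow> 'a \<Rightarrow> 'a \<Rightarrow> nat" where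
  "gdist G x y = (LEAST k. \<exists>p. pre_digraph.apath (with_proj G) x p y \<and> length p = k)"

definition diameter :: "'a pair_pre_digraph \<Rightarrow> nat" where
  "diameter G = Max {gdist G x y | x y. x \<in> pverts G \<and> y \<in> pverts G}"

text \<open>The sum ranges over the unordered pairs of distinct vertices; the description in the
  denominator is unique because the distance is symmetric.\<close>

definition harary_index :: "'a pair_pre_digraph \<Rightarrow> real" where
  "harary_index G = (\<Sum>e | e \<subseteq> pverts G \<and> card e = 2.
     1 / real (THE k. \<exists>x y. e = {x, y} \<and> k = gdist G x y))"

text \<open>The constant \<^const>\<open>tree\<close> does not fit this representation, since it
  counts an arc followed by its reverse as a cycle. Cycles of a simple graph are those of length
  at least 3.\<close>

definition undirected_tree :: "'a pair_pre_digraph \<Rightarrow> bool" where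
  "undirected_tree G \<longleftrightarrow> pair_graph G \<and> Digraph_Component.connected (with_proj G) \<and>
     \<not> (\<exists>p. pre_digraph.cycle (with_proj G) p \<and> 3 \<le> length p)"

text \<open>The vertices \<open>0, \<dots>, d\<close> form the path and \<open>d + 1, \<dots>, n - 1\<close> are the pendent vertices
  attached to \<open>i\<close>. Meaningful for \<open>d < n\<close> and \<open>1 \<le> i \<le> d - 1\<close>.\<close>

definition caterpillar :: "nat \<Rightarrow> nat \<Rightarrow> nat \<Rightarrow> nat pair_pre_digraph" where
  "caterpillar n d i = (let A = {(k, Suc k) | k. k < d} \<union> {(i, j) | j. d < j \<and> j < n}
     in \<lparr> pverts = {0..<n}, parcs = A \<union> A\<inverse> \<rparr>)"

definition trees_of_diameter :: "nat \<Rightarrow> nat \<Rightarrow> 'a pair_pre_digraph set" where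
  "trees_of_diameter n d = {T. undirected_tree T \<and> card (pverts T) = n \<and> diameter T = d}"

lemma gdist_commute:
  assumes "pair_graph G"
  shows "gdist G x y = gdist G y x"
proof -
  interpret pair_graph G by fact
  have len: "length (rev_path p) = length p" for p :: "('a \<times> 'a) list"
    by (induction p) auto
  have "(\<exists>p. apath x p y \<and> length p = k) \<longleftrightarrow> (\<exists>p. apath y p x \<and> length p = k)" for k
    by (metis apath_rev_path len)
  then show ?thesis by (simp add: gdist_def)
qed

lemma harary_index_altdef:
  assumes "pair_graph G"
  shows "harary_index G =
    (\<Sum>(x, y) \<in> {(x, y). x \<in> pverts G \<and> y \<in> pverts G \<and> x \<noteq> y}. 1 / real (gdist G x y)) / 2"
proof -
  interpret pair_graph G by fact
  let ?V = "pverts G"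
  let ?P = "{(x, y). x \<in> ?V \<and> y \<in> ?V \<and> x \<noteq> y}"
  let ?E = "{e. e \<subseteq> ?V \<and> card e = 2}"
  let ?f = "\<lambda>(x, y). 1 / real (gdist G x y)"
  let ?g = "\<lambda>(x, y). {x, y}"
  have finV: "finite ?V" by (rule pair_finite_verts)
  have finP: "finite ?P" by (rule finite_subset[of _ "?V \<times> ?V"]) (use finV in auto)
  have finE: "finite ?E" using finV by (auto intro: finite_subset[of _ "Pow ?V"])
  have sub: "?g ` ?P \<subseteq> ?E" by (auto simp: card_2_iff)
  have "sum ?f ?P = (\<Sum>e\<in>?E. sum ?f {q \<in> ?P. ?g q = e})"
    using sum.group[OF finP finE sub, of ?f] by simp
  also have "\<dots> = (\<Sum>e\<in>?E. 2 * (1 / real (THE k. \<exists>x y. e = {x, y} \<and> k = gdist G x y)))"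
  proof (rule sum.cong[OF refl])
    fix e assume "e \<in> ?E"
    then obtain x y where e: "e = {x, y}" "x \<noteq> y" "x \<in> ?V" "y \<in> ?V"
      by (auto simp: card_2_iff)
    have the: "(THE k. \<exists>x y. e = {x, y} \<and> k = gdist G x y) = gdist G x y"
      by (rule the_equality) (auto simp: e doubleton_eq_iff gdist_commute[OF assms])
    have "{q \<in> ?P. ?g q = e} = {(x, y), (y, x)}"
      using e by (auto simp: doubleton_eq_iff)
    then show "sum ?f {q \<in> ?P. ?g q = e}
      = 2 * (1 / real (THE k. \<exists>x y. e = {x, y} \<and> k = gdist G x y))"
      using e(2) unfolding the by (simp add: gdist_commute[OF assms, of y x])
  qed
  also have "\<dots> = 2 * harary_index G"
    by (simp add: harary_index_def sum_distrib_left)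
  finally show ?thesis by simp
qed

end

theory Submission
  imports Defs
begin

text \<open>Let \<open>v\<^sub>0, \<dots>, v\<^sub>d\<close> be a diametral path of a tree. Every other vertex \<open>x\<close> reaches the path at a
  unique vertex \<open>v\<^sub>g\<close>, at height \<open>h \<ge> 1\<close>, so its contribution with the path is the sum of
  \<open>1 / (h + \<bar>i - g\<bar>)\<close> over \<open>i \<le> d\<close>. For \<open>h = 1\<close> this is maximal exactly when \<open>g\<close> is a centre of the path,
  and raising \<open>h\<close> above \<open>1\<close> costs more than \<open>1 / 2\<close>. Two vertices off the path contribute at most
  \<open>1 / 2\<close>, unless they are adjacent, when they contribute \<open>1\<close>; but every such adjacent pair can be
  charged to a vertex of height at least 2, whose loss exceeds the gain. Equality forces all
  heights to be 1 and all distances off the path to be 2, which is the caterpillar.\<close>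

section \<open>Distances in connected graphs\<close>

locale connected_pair_graph = pair_graph +
  assumes connected: "connected (with_proj G)"
begin

text \<open>\<open>gdist\<close> minimises over paths only. A walk shortens to a path that uses some
  of its arcs, each at most once, so the minimum also bounds walks.\<close>

lemma gdist_le_awalk:
  assumes "awalk x p y"
  shows "gdist G x y \<le> length p"
proof -
  let ?q = "awalk_to_apath p"
  have q: "apath x ?q y" using assms by (rule apath_awalk_to_apath)
  have "distinct ?q" using q by (auto simp: apath_def intro: distinct_verts_imp_distinct)
  then have "length ?q = card (set ?q)" by (simp add: distinct_card)
  also have "\<dots> \<le> card (set p)" using awalk_to_apath_subset[OF assms] by (simp add: card_mono)
  also have "\<dots> \<le> length p" by (rule card_length)
  finally have "length ?q \<le> length p" .
  moreover have "gdist G x y \<le> length ?q" unfolding gdist_def using q by (intro Least_le) blast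
  ultimately show ?thesis by linarith
qed

lemma gdist_awalk:
  assumes "x \<in> pverts G" "y \<in> pverts G"
  obtains p where "awalk x p y" "length p = gdist G x y"
proof -
  have "x \<rightarrow>\<^sup>*\<^bsub>with_proj G\<^esub> y"
    using symmetric_connected_imp_strongly_connected[OF sym_arcs connected] assms
    by (auto simp: strongly_connected_def)
  then have "\<exists>k p. apath x p y \<and> length p = k"
    using reachable_apath by blast
  then have "\<exists>p. apath x p y \<and> length p = gdist G x y"
    unfolding gdist_def by (rule LeastI_ex)
  then show ?thesis using that awalkI_apath by blast
qed

lemma gdist_sym: "gdist G x y = gdist G y x"
  by (rule gdist_commute) (rule pair_graph)

lemma gdist_self [simp]: "x \<in> pverts G \<Longrightarrow> gdist G x x = 0"
  using gdist_le_awalk[of x "[]" x] by (simp add: awalk_Nil_iff)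

lemma gdist_eq_0_iff [simp]:
  assumes "x \<in> pverts G" "y \<in> pverts G"
  shows "gdist G x y = 0 \<longleftrightarrow> x = y"
  using gdist_awalk[OF assms] assms by (metis awalk_empty_ends gdist_self length_0_conv)

lemma gdist_triangle:
  assumes "x \<in> pverts G" "y \<in> pverts G" "z \<in> pverts G"
  shows "gdist G x z \<le> gdist G x y + gdist G y z"
proof -
  obtain p where p: "awalk x p y" "length p = gdist G x y" using gdist_awalk assms by blast
  obtain q where q: "awalk y q z" "length q = gdist G y z" using gdist_awalk assms by blast
  show ?thesis using gdist_le_awalk[OF awalk_appendI[OF p(1) q(1)]] p q by simp
qed

lemma gdist_eq_1_iff:
  assumes "x \<in> pverts G" "y \<in> pverts G"
  shows "gdist G x y = 1 \<longleftrightarrow> (x, y) \<in> parcs G"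
proof
  assume *: "gdist G x y = 1"
  obtain p where p: "awalk x p y" "length p = gdist G x y" using gdist_awalk assms by blast
  then obtain e where "p = [e]" using * by (auto simp: length_Suc_conv)
  then show "(x, y) \<in> parcs G" using p by (cases e) (auto simp: awalk_simps)
next
  assume *: "(x, y) \<in> parcs G"
  then have "awalk x [(x, y)] y" using assms by (simp add: awalk_simps)
  then have "gdist G x y \<le> 1" using gdist_le_awalk[of x "[(x, y)]" y] by simp
  moreover have "gdist G x y \<noteq> 0" using no_loops'[OF *] assms by simp
  ultimately show "gdist G x y = 1" by linarith
qed

lemma gdist_arc_le:
  assumes "x \<in> pverts G" "(y, z) \<in> parcs G"
  shows "gdist G x z \<le> Suc (gdist G x y)"
  using gdist_triangle[of x y z] gdist_eq_1_iff[of y z] assms in_arcsD1[OF assms(2)] in_arcsD2[OF assms(2)]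
  by simp

lemma obtain_predecessor:
  assumes "x \<in> pverts G" "y \<in> pverts G" "x \<noteq> y"
  obtains z where "(z, y) \<in> parcs G" "gdist G x y = Suc (gdist G x z)"
proof -
  obtain p where p: "awalk y p x" "length p = gdist G y x" using gdist_awalk assms by blast
  then obtain e q where "p = e # q" using assms(3) by (cases p) (auto simp: awalk_simps)
  then obtain z where z: "(y, z) \<in> parcs G" "awalk z q x" and len: "length q + 1 = gdist G x y"
    using p by (cases e) (auto simp: awalk_simps gdist_sym)
  have "gdist G x z \<le> length q" using gdist_le_awalk[OF z(2)] by (simp add: gdist_sym)
  moreover have "gdist G x y \<le> Suc (gdist G x z)"
    by (rule gdist_arc_le) (use assms z arcs_symmetric in auto)
  ultimately have "gdist G x y = Suc (gdist G x z)" using len by linarith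
  then show ?thesis using that z(1) arcs_symmetric by blast
qed

lemma gdist_chain_le:
  assumes "v 0 \<in> pverts G" "\<And>i. i < k \<Longrightarrow> (v i, v (Suc i)) \<in> parcs G"
  shows "gdist G (v 0) (v k) \<le> k"
  using assms(2)
proof (induction k)
  case 0
  then show ?case using assms(1) by simp
next
  case (Suc k)
  then have "gdist G (v 0) (v k) \<le> k" "(v k, v (Suc k)) \<in> parcs G" by auto
  then show ?case using gdist_arc_le[OF assms(1), of "v k" "v (Suc k)"] by linarith
qed

text \<open>A tool for lower bounds on distances: a potential that changes by at most 1 along each
  arc changes by at most the distance between two vertices.\<close>

lemma lipschitz_le_gdist:
  fixes f :: "'a \<Rightarrow> int"
  assumes "\<And>x y. (x, y) \<in> parcs G \<Longrightarrow> f x \<le> f y + 1" "x \<in> pverts G" "y \<in> pverts G"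
  shows "f x \<le> f y + int (gdist G x y)"
proof -
  obtain p where p: "awalk x p y" "length p = gdist G x y" using gdist_awalk assms by blast
  have "f x \<le> f y + int (length p)" using p(1)
  proof (induction p arbitrary: x)
    case (Cons e p)
    then obtain w where "(x, w) \<in> parcs G" "awalk w p y" by (cases e) (auto simp: awalk_simps)
    then show ?case using Cons.IH[of w] assms(1)[of x w] by simp
  qed (simp add: awalk_simps)
  then show ?thesis using p(2) by simp
qed

lemma gdist_le_diameter:
  assumes "x \<in> pverts G" "y \<in> pverts G"
  shows "gdist G x y \<le> diameter G"
proof -
  have "finite ((\<lambda>(x, y). gdist G x y) ` (pverts G \<times> pverts G))" using pair_finite_verts by blast
  moreover have "(\<lambda>(x, y). gdist G x y) ` (pverts G \<times> pverts G)
      = {gdist G x y | x y. x \<in> pverts G \<and> y \<in> pverts G}" by auto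
  ultimately show ?thesis unfolding diameter_def by (intro Max_ge) (use assms in auto)
qed

lemma obtain_diametral_pair:
  obtains x y where "x \<in> pverts G" "y \<in> pverts G" "gdist G x y = diameter G"
proof -
  let ?D = "{gdist G x y | x y. x \<in> pverts G \<and> y \<in> pverts G}"
  have "finite ((\<lambda>(x, y). gdist G x y) ` (pverts G \<times> pverts G))" using pair_finite_verts by blast
  moreover have "(\<lambda>(x, y). gdist G x y) ` (pverts G \<times> pverts G) = ?D" by auto
  \<comment> \<open>Connectedness includes having a vertex, so the \<open>Max\<close> is taken over
    a nonempty set.\<close>
  moreover have "pverts G \<noteq> {}" using connected unfolding connected_conv by auto
  then have "?D \<noteq> {}" by auto
  ultimately have "Max ?D \<in> ?D" by (intro Max_in) auto
  then show ?thesis using that unfolding diameter_def by auto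
qed

text \<open>The path is built backwards from \<open>y\<close>, each predecessor being one step
  nearer to \<open>x\<close>. Between two of its vertices the arcs give the upper bound on the
  distance, and the distances from \<open>x\<close> with the triangle inequality give the lower
  one.\<close>

lemma obtain_geodesic:
  assumes "x \<in> pverts G" "y \<in> pverts G"
  obtains v where "\<And>i. i \<le> gdist G x y \<Longrightarrow> v i \<in> pverts G"
    "\<And>i j. i \<le> gdist G x y \<Longrightarrow> j \<le> gdist G x y \<Longrightarrow> gdist G (v i) (v j) = (i - j) + (j - i)"
proof -
  have "\<exists>v. v 0 = x \<and> v k = y \<and> (\<forall>i<k. (v i, v (Suc i)) \<in> parcs G) \<and> (\<forall>i\<le>k. gdist G x (v i) = i)"
    if "y \<in> pverts G" "gdist G x y = k" for y k
    using that
  proof (induction k arbitrary: y)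
    case 0
    then show ?case using assms(1) by (intro exI[of _ "\<lambda>_. x"]) auto
  next
    case (Suc k)
    then have "x \<noteq> y" using assms(1) by auto
    then obtain z where z: "(z, y) \<in> parcs G" "gdist G x y = Suc (gdist G x z)"
      using obtain_predecessor assms(1) Suc.prems by blast
    then obtain v where v: "v 0 = x" "v k = z" "\<forall>i<k. (v i, v (Suc i)) \<in> parcs G"
      "\<forall>i\<le>k. gdist G x (v i) = i"
      using Suc.IH[of z] in_arcsD1 Suc.prems by auto
    then show ?case
      using z(1) Suc.prems(2)
      by (intro exI[of _ "v(Suc k := y)"]) (auto simp: le_Suc_eq less_Suc_eq)
  qed
  then obtain v where v: "v 0 = x" "\<And>i. i < gdist G x y \<Longrightarrow> (v i, v (Suc i)) \<in> parcs G"
    "\<And>i. i \<le> gdist G x y \<Longrightarrow> gdist G x (v i) = i"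
    using assms(2) by blast
  have verts: "v i \<in> pverts G" if "i \<le> gdist G x y" for i
    using that v(1,2) assms(1) in_arcsD2[of "v (i - 1)" "v i"] by (cases i) auto
  have mono: "gdist G (v i) (v j) = j - i" if "i \<le> j" "j \<le> gdist G x y" for i j
  proof (rule antisym)
    show "gdist G (v i) (v j) \<le> j - i"
      using gdist_chain_le[of "\<lambda>l. v (i + l)" "j - i"] verts[of i] v(2) that by auto
    show "j - i \<le> gdist G (v i) (v j)"
      using gdist_triangle[of x "v i" "v j"] verts v(3) assms(1) that by fastforce
  qed
  show ?thesis
  proof (rule that)
    show "gdist G (v i) (v j) = (i - j) + (j - i)" if "i \<le> gdist G x y" "j \<le> gdist G x y" for i j
      using mono[of i j] mono[of j i] that gdist_sym[of "v i" "v j"] by (cases "i \<le> j") auto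
  qed (rule verts)
qed

end

section \<open>Trees\<close>

locale tree_graph = connected_pair_graph +
  assumes no_cycle: "\<not> (\<exists>p. cycle p \<and> 3 \<le> length p)"
begin

text \<open>Otherwise the shortest walks from \<open>x\<close> to two such neighbours avoid \<open>y\<close>, so they are joined by
  a path avoiding \<open>y\<close>, which \<open>y\<close> closes to a cycle.\<close>

lemma unique_lower_neighbour:
  assumes "x \<in> pverts G" and a: "(a, y) \<in> parcs G" "gdist G x a \<le> gdist G x y"
    and b: "(b, y) \<in> parcs G" "gdist G x b \<le> gdist G x y"
  shows "a = b"
proof (rule ccontr)
  assume "a \<noteq> b"
  have avoid: "\<exists>p. awalk x p a \<and> y \<notin> set (awalk_verts x p)"
    if a: "(a, y) \<in> parcs G" "gdist G x a \<le> gdist G x y" for a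
  proof -
    obtain p where p: "awalk x p a" "length p = gdist G x a"
      using gdist_awalk assms(1) in_arcsD1[OF a(1)] by blast
    have "y \<notin> set (awalk_verts x p)"
    proof
      assume "y \<in> set (awalk_verts x p)"
      then obtain q r where qr: "p = q @ r" "awalk x q y" "awalk y r a" using awalk_decomp p by blast
      moreover have "length p = length q + length r" using qr(1) by simp
      \<comment> \<open>\<open>q\<close> already has length at least \<open>gdist G x y\<close>, and
        the whole of \<open>p\<close> has no more, so nothing is left for \<open>r\<close>.\<close>
      ultimately have "length r = 0" using gdist_le_awalk[OF qr(2)] p(2) a(2) by linarith
      then have "r = []" by simp
      then have "y = a" using qr(3) by (simp add: awalk_simps)
      then show False using a no_loops' by blast
    qed
    then show ?thesis using p by blast
  qed
  obtain p where p: "awalk x p a" "y \<notin> set (awalk_verts x p)" using avoid a by blast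
  obtain q where q: "awalk x q b" "y \<notin> set (awalk_verts x q)" using avoid b by blast
  have pr: "awalk a (rev_path p) x" using p by simp
  have w: "awalk a (rev_path p @ q) b" using pr q(1) by (rule awalk_appendI)
  have y: "y \<notin> set (awalk_verts a (rev_path p @ q))"
    using set_awalk_verts_append[OF pr q(1)] p q awalk_verts_rev_path[OF p(1)] by simp
  define r where "r = awalk_to_apath (rev_path p @ q)"
  have r: "apath a r b" unfolding r_def using w by (rule apath_awalk_to_apath)
  have "set r \<subseteq> set (rev_path p @ q)" unfolding r_def using w by (rule awalk_to_apath_subset)
  then have yr: "y \<notin> set (awalk_verts a r)"
    using y set_awalk_verts[OF w] set_awalk_verts[OF awalkI_apath[OF r]] by auto
  have rb: "awalk a (r @ [(b, y)]) y"
    using awalkI_apath[OF r] b(1) by (intro awalk_appendI[of a r b]) (auto simp: awalk_simps in_arcsD2)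
  have "awalk y ((y, a) # r @ [(b, y)]) y"
    using rb arcs_symmetric[OF a(1)] by (simp only: awalk_simps) auto
  moreover have "distinct (tl (awalk_verts y ((y, a) # r @ [(b, y)])))"
    using r yr awalk_verts_append[OF rb] by (auto simp: apath_def)
  ultimately have "cycle ((y, a) # r @ [(b, y)])" unfolding cycle_def by blast
  moreover have "r \<noteq> []" using r \<open>a \<noteq> b\<close> by (auto simp: apath_simps)
  then have "3 \<le> length ((y, a) # r @ [(b, y)])" by (cases r) auto
  ultimately show False using no_cycle by blast
qed

text \<open>If the distances were equal, \<open>a\<close> and a predecessor of \<open>y\<close>
  would both be neighbours of \<open>y\<close> no farther from \<open>x\<close>, hence the same
  vertex, although the predecessor is strictly nearer. This is the bipartiteness of trees.\<close>

lemma gdist_neq_of_arc: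
  assumes "x \<in> pverts G" "(a, y) \<in> parcs G"
  shows "gdist G x a \<noteq> gdist G x y"
proof
  assume eq: "gdist G x a = gdist G x y"
  have y: "y \<in> pverts G" "a \<in> pverts G" "a \<noteq> y" using assms in_arcsD1 in_arcsD2 no_loops' by blast+
  then have "x \<noteq> y" using eq assms(1) by (metis gdist_eq_0_iff)
  then obtain z where z: "(z, y) \<in> parcs G" "gdist G x y = Suc (gdist G x z)"
    using obtain_predecessor assms(1) y by blast
  then have "z = a" using unique_lower_neighbour[OF assms(1), of z y a] assms(2) eq by simp
  then show False using z eq by simp
qed

text \<open>A walk without backtracking that never gets nearer than its start must first step away
  from \<open>x\<close>. It can never turn back later, since the turning point would have two
  different neighbours no farther from \<open>x\<close>.\<close>

lemma gdist_ray:
  assumes "x \<in> pverts G"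
    and "\<And>i. i < k \<Longrightarrow> (w i, w (Suc i)) \<in> parcs G" "\<And>i. i \<le> k \<Longrightarrow> gdist G x (w 0) \<le> gdist G x (w i)"
    and "\<And>i. Suc (Suc i) \<le> k \<Longrightarrow> w i \<noteq> w (Suc (Suc i))"
  shows "i \<le> k \<Longrightarrow> gdist G x (w i) = gdist G x (w 0) + i"
proof (induction i rule: induct_nat_012)
  case 1
  then have a: "(w 0, w 1) \<in> parcs G" using assms(2)[of 0] by simp
  show ?case
    using gdist_arc_le[OF assms(1) a] gdist_neq_of_arc[OF assms(1) a] assms(3)[of 1] 1 by simp
next
  case (ge2 j)
  have a: "(w j, w (Suc j)) \<in> parcs G" "(w (Suc j), w (Suc (Suc j))) \<in> parcs G"
    using assms(2) ge2.prems by auto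
  have d: "gdist G x (w j) = gdist G x (w 0) + j" "gdist G x (w (Suc j)) = gdist G x (w 0) + Suc j"
    using ge2 by auto
  have "\<not> gdist G x (w (Suc (Suc j))) \<le> gdist G x (w (Suc j))"
  proof
    assume "gdist G x (w (Suc (Suc j))) \<le> gdist G x (w (Suc j))"
    then have "w j = w (Suc (Suc j))"
      using unique_lower_neighbour[OF assms(1) a(1) _ arcs_symmetric[OF a(2)]] d by simp
    then show False using assms(4)[of j] ge2.prems by simp
  qed
  then show ?case using gdist_arc_le[OF assms(1) a(2)] d by simp
qed simp

end

section \<open>Distances from an isometric path\<close>

text \<open>In truncated subtraction \<open>(i - j) + (j - i)\<close> is \<open>\<bar>i - j\<bar>\<close>.\<close>

definition spine_sum :: "nat \<Rightarrow> nat \<Rightarrow> nat \<Rightarrow> real" where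
  "spine_sum d j h = (\<Sum>i\<le>d. 1 / real (h + ((i - j) + (j - i))))"

text \<open>Cutting the path at \<open>j\<close> leaves two harmonic sums. Both contain the term 1
  of the vertex \<open>j\<close> itself, which is subtracted once.\<close>

lemma spine_sum_1_eq:
  assumes "j \<le> d"
  shows "spine_sum d j 1 = (\<Sum>i\<le>j. 1 / real (Suc i)) + (\<Sum>i\<le>d - j. 1 / real (Suc i)) - 1"
proof -
  let ?f = "\<lambda>i. 1 / real (Suc ((i - j) + (j - i)))"
  have "spine_sum d j 1 = sum ?f {..<Suc d}" by (simp add: spine_sum_def lessThan_Suc_atMost)
  also have "\<dots> = sum ?f {..<Suc j} + sum ?f {Suc j..<Suc d}"
    unfolding lessThan_atLeast0 using assms by (intro sum.atLeastLessThan_concat[symmetric]) auto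
  \<comment> \<open>The denominator is written in the shape that \<open>sum.nat_diff_reindex\<close>
    reverses.\<close>
  also have "sum ?f {..<Suc j} = (\<Sum>i<Suc j. 1 / real (Suc (Suc j - Suc i)))"
    by (rule sum.cong) auto
  also have "\<dots> = (\<Sum>i\<le>j. 1 / real (Suc i))"
    by (subst sum.nat_diff_reindex) (simp add: lessThan_Suc_atMost)
  also have "sum ?f {Suc j..<Suc d} = (\<Sum>i<d - j. 1 / real (Suc (Suc i)))"
    using sum.shift_bounds_nat_ivl[of ?f 0 "Suc j" "d - j"] assms by (simp add: lessThan_atLeast0)
  also have "(\<Sum>i<d - j. 1 / real (Suc (Suc i))) = (\<Sum>i\<le>d - j. 1 / real (Suc i)) - 1"
    unfolding lessThan_Suc_atMost[symmetric] by (subst sum.lessThan_Suc_shift) simp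
  finally show ?thesis by simp
qed

lemma spine_sum_reflect: "j \<le> d \<Longrightarrow> spine_sum d (d - j) 1 = spine_sum d j 1"
  by (simp add: spine_sum_1_eq del: One_nat_def)

text \<open>Moving the gate from \<open>j\<close> to \<open>Suc j\<close> gains
  \<open>1 / (j + 2)\<close> and loses \<open>1 / (d - j + 1)\<close>, a net gain left of the
  middle.\<close>

lemma spine_sum_Suc_less:
  assumes "Suc (2 * j) < d"
  shows "spine_sum d j 1 < spine_sum d (Suc j) 1"
proof -
  define k where "k = d - Suc j"
  have k: "d - j = Suc k" "d - Suc j = k" "j < k" using assms by (auto simp: k_def)
  have "1 / real (Suc (Suc k)) < 1 / real (Suc (Suc j))"
    using k(3) by (intro divide_strict_left_mono) auto
  then show ?thesis using assms by (simp add: spine_sum_1_eq k del: One_nat_def)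
qed

lemma spine_sum_strict_mono:
  assumes "j < c" "2 * c \<le> d"
  shows "spine_sum d j 1 < spine_sum d c 1"
  using assms
proof (induction c)
  case (Suc c)
  then have "spine_sum d c 1 < spine_sum d (Suc c) 1" by (intro spine_sum_Suc_less) auto
  moreover have "spine_sum d j 1 \<le> spine_sum d c 1" using Suc by (cases "j = c") auto
  ultimately show ?case by linarith
qed simp

text \<open>The sum increases up to \<open>d div 2\<close>, and the right half is the mirror image
  of the left. The two centres coincide for even \<open>d\<close> and are exchanged by the
  reflection for odd \<open>d\<close>.\<close>

lemma spine_sum_less_centre:
  assumes "j \<le> d" "j \<noteq> d div 2" "j \<noteq> d - d div 2"
  shows "spine_sum d j 1 < spine_sum d (d div 2) 1"
proof (cases "j < d div 2")
  case True
  then show ?thesis by (rule spine_sum_strict_mono) simp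
next
  case False
  then have "d - j < d div 2" using assms by linarith
  then have "spine_sum d (d - j) 1 < spine_sum d (d div 2) 1" by (rule spine_sum_strict_mono) simp
  then show ?thesis using spine_sum_reflect assms(1) by simp
qed

lemma spine_sum_le_centre:
  assumes "j \<le> d"
  shows "spine_sum d j 1 \<le> spine_sum d (d div 2) 1"
  using assms spine_sum_less_centre[of j d] spine_sum_reflect[of "d div 2" d] by fastforce

text \<open>The term at the gate falls from 1 to at most 1/2, which is already the claimed loss.
  Strictness comes from the other path vertices, whose terms all decrease.\<close>

lemma spine_sum_height:
  assumes "j \<le> d" "0 < d" "2 \<le> h"
  shows "spine_sum d j h + 1 / 2 < spine_sum d j 1"
proof -
  let ?D = "\<lambda>i. (i - j) + (j - i)"
  have split: "spine_sum d j k = 1 / real k + (\<Sum>i\<in>{..d} - {j}. 1 / real (k + ?D i))" for k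
    unfolding spine_sum_def using assms(1) by (subst sum.remove[of _ j]) auto
  have "(\<Sum>i\<in>{..d} - {j}. 1 / real (h + ?D i)) < (\<Sum>i\<in>{..d} - {j}. 1 / real (1 + ?D i))"
  proof (rule sum_strict_mono)
    \<comment> \<open>One of 0 and 1 differs from \<open>j\<close>, and both are at most
      \<open>d\<close> because \<open>d\<close> is positive.\<close>
    have "(if j = 0 then 1 else 0) \<in> {..d} - {j}" using assms by auto
    then show "{..d} - {j} \<noteq> {}" by blast
    show "1 / real (h + ?D i) < 1 / real (1 + ?D i)" for i
      using assms(3) by (intro divide_strict_left_mono) auto
  qed simp
  moreover have "1 / real h \<le> 1 / 2" using assms(3) by (intro divide_left_mono) auto
  ultimately show ?thesis using split[of h] split[of 1] by simp
qed

section \<open>Gates and heights relative to an isometric path\<close>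

text \<open>Instances are a diametral path of an arbitrary tree, the same path reversed, and the
  spine \<open>0, ..., d\<close> of the caterpillar, so one computation of the index serves all of
  them.\<close>

locale tree_with_path = tree_graph +
  fixes v :: "nat \<Rightarrow> 'a" and d :: nat
  assumes d_pos: "0 < d"
    and path_verts: "\<And>i. i \<le> d \<Longrightarrow> v i \<in> pverts G"
    and path_gdist: "\<And>i j. i \<le> d \<Longrightarrow> j \<le> d \<Longrightarrow> gdist G (v i) (v j) = (i - j) + (j - i)"
begin

lemma path_arc: "i \<le> d \<Longrightarrow> j \<le> d \<Longrightarrow> (v i, v j) \<in> parcs G \<longleftrightarrow> (i - j) + (j - i) = 1"
  using gdist_eq_1_iff[of "v i" "v j"] path_verts path_gdist by simp

lemma path_inj: "inj_on v {..d}"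
proof (rule inj_onI)
  fix i j assume "i \<in> {..d}" "j \<in> {..d}" "v i = v j"
  then show "i = j" using path_gdist[of i j] path_verts[of j] by simp
qed

text \<open>The gate is a nearest path vertex. From there the path runs in both directions without
  backtracking and never gets nearer to \<open>x\<close>, so \<open>gdist_ray\<close> applies to
  each half.\<close>

lemma obtain_gate:
  assumes "x \<in> pverts G"
  obtains g where "g \<le> d" "\<And>i. i \<le> d \<Longrightarrow> gdist G x (v i) = gdist G x (v g) + ((i - g) + (g - i))"
proof -
  obtain g where g: "g \<le> d" "\<And>i. i \<le> d \<Longrightarrow> gdist G x (v g) \<le> gdist G x (v i)"
    using arg_min_nat_lemma[of "\<lambda>i. i \<le> d" 0 "\<lambda>i. gdist G x (v i)"] by blast
  have up: "gdist G x (v (g + i)) = gdist G x (v g) + i" if "g + i \<le> d" for i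
  proof -
    have "gdist G x (v (g + i)) = gdist G x (v (g + 0)) + i"
    proof (rule gdist_ray[where k = "d - g"])
      show "v (g + j) \<noteq> v (g + Suc (Suc j))" if "Suc (Suc j) \<le> d - g" for j
      proof -
        have "g + Suc (Suc j) \<le> d" using that g(1) by linarith
        then show ?thesis using inj_onD[OF path_inj, of "g + j" "g + Suc (Suc j)"] by auto
      qed
    qed (use assms g that path_arc in auto)
    then show ?thesis by simp
  qed
  have down: "gdist G x (v (g - i)) = gdist G x (v g) + i" if "i \<le> g" for i
  proof -
    have "gdist G x (v (g - i)) = gdist G x (v (g - 0)) + i"
    proof (rule gdist_ray[where k = g])
      show "v (g - j) \<noteq> v (g - Suc (Suc j))" if "Suc (Suc j) \<le> g" for j
      proof -
        have "g - j \<le> d" "g - Suc (Suc j) \<le> d" "g - j \<noteq> g - Suc (Suc j)" using that g(1) by linarith+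
        then show ?thesis using inj_onD[OF path_inj, of "g - j" "g - Suc (Suc j)"] by auto
      qed
    qed (use assms g that path_arc in auto)
    then show ?thesis by simp
  qed
  show ?thesis
  proof (rule that[OF g(1)])
    show "gdist G x (v i) = gdist G x (v g) + ((i - g) + (g - i))" if "i \<le> d" for i
      using up[of "i - g"] down[of "g - i"] that by (cases "g \<le> i") auto
  qed
qed

text \<open>For a vertex \<open>x\<close> the condition makes \<open>v g\<close> the only path
  vertex nearest to \<open>x\<close>, so the choice is determined; a path vertex is its own
  gate.\<close>

definition gate :: "'a \<Rightarrow> nat" where
  "gate x = (SOME g. g \<le> d \<and> (\<forall>i\<le>d. gdist G x (v i) = gdist G x (v g) + ((i - g) + (g - i))))"

definition height :: "'a \<Rightarrow> nat" where
  "height x = gdist G x (v (gate x))"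

lemma
  assumes "x \<in> pverts G"
  shows gate_le: "gate x \<le> d"
    and gdist_path: "i \<le> d \<Longrightarrow> gdist G x (v i) = height x + ((i - gate x) + (gate x - i))"
proof -
  have "gate x \<le> d \<and> (\<forall>i\<le>d. gdist G x (v i) = gdist G x (v (gate x)) + ((i - gate x) + (gate x - i)))"
    unfolding gate_def by (rule someI_ex) (use obtain_gate[OF assms] in blast)
  then show "gate x \<le> d" "i \<le> d \<Longrightarrow> gdist G x (v i) = height x + ((i - gate x) + (gate x - i))"
    unfolding height_def by blast+
qed

definition hanging :: "'a set" where
  "hanging = pverts G - v ` {..d}"

lemma hangingD: "x \<in> hanging \<Longrightarrow> x \<in> pverts G"
  by (simp add: hanging_def)

lemma finite_hanging [simp]: "finite hanging"
  using pair_finite_verts by (simp add: hanging_def)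

lemma verts_decomp: "pverts G = v ` {..d} \<union> hanging" "v ` {..d} \<inter> hanging = {}"
  using path_verts by (auto simp: hanging_def)

lemma card_hanging: "card hanging = card (pverts G) - Suc d"
proof -
  have "card (v ` {..d}) = Suc d" using path_inj by (simp add: card_image)
  then show ?thesis unfolding hanging_def using path_verts by (subst card_Diff_subset) auto
qed

lemma height_pos:
  assumes "x \<in> hanging"
  shows "0 < height x"
proof (rule ccontr)
  assume "\<not> 0 < height x"
  then have "x = v (gate x)"
    using gdist_eq_0_iff[of x "v (gate x)"] path_verts gate_le hangingD[OF assms] by (simp add: height_def)
  then show False using assms gate_le[OF hangingD[OF assms]] by (auto simp: hanging_def)
qed

section \<open>The Harary index split along the path\<close>

lemma sum_verts: "sum f (pverts G) = (\<Sum>i\<le>d. f (v i)) + sum f hanging" for f :: "'a \<Rightarrow> real"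
  by (subst verts_decomp(1), subst sum.union_disjoint) (use verts_decomp(2) path_inj in \<open>auto simp: sum.reindex\<close>)

text \<open>Thanks to \<open>1 / 0 = 0\<close>, sums over all ordered pairs may include the diagonal.\<close>

lemma harary_index_eq:
  "2 * harary_index G = (\<Sum>j\<le>d. spine_sum d j 0) + 2 * (\<Sum>x\<in>hanging. spine_sum d (gate x) (height x))
     + (\<Sum>x\<in>hanging. \<Sum>y\<in>hanging. 1 / real (gdist G x y))"
proof -
  let ?f = "\<lambda>x y. 1 / real (gdist G x y)"
  have "2 * harary_index G
      = (\<Sum>(x, y) \<in> {(x, y). x \<in> pverts G \<and> y \<in> pverts G \<and> x \<noteq> y}. ?f x y)"
    by (subst harary_index_altdef[OF pair_graph]) simp
  also have "\<dots> = (\<Sum>(x, y) \<in> pverts G \<times> pverts G. ?f x y)"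
    by (rule sum.mono_neutral_left) (auto simp: pair_finite_verts)
  also have "\<dots> = (\<Sum>x\<in>pverts G. \<Sum>y\<in>pverts G. ?f x y)"
    by (simp add: sum.cartesian_product)
  also have "\<dots> = (\<Sum>j\<le>d. \<Sum>i\<le>d. ?f (v j) (v i)) + (\<Sum>j\<le>d. \<Sum>x\<in>hanging. ?f (v j) x)
     + ((\<Sum>x\<in>hanging. \<Sum>j\<le>d. ?f x (v j)) + (\<Sum>x\<in>hanging. \<Sum>y\<in>hanging. ?f x y))"
    by (simp add: sum_verts sum.distrib)
  also have "(\<Sum>j\<le>d. \<Sum>x\<in>hanging. ?f (v j) x) = (\<Sum>x\<in>hanging. \<Sum>j\<le>d. ?f x (v j))"
    by (subst sum.swap) (simp add: gdist_sym)
  also have "(\<Sum>x\<in>hanging. \<Sum>j\<le>d. ?f x (v j)) = (\<Sum>x\<in>hanging. spine_sum d (gate x) (height x))"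
    by (rule sum.cong) (auto simp: spine_sum_def gdist_path hangingD)
  \<comment> \<open>A path vertex counts as one of height 0 at its own index; the term
    \<open>i = j\<close> is \<open>1 / 0 = 0\<close>.\<close>
  also have "(\<Sum>j\<le>d. \<Sum>i\<le>d. ?f (v j) (v i)) = (\<Sum>j\<le>d. spine_sum d j 0)"
    by (rule sum.cong) (auto simp: spine_sum_def path_gdist add.commute)
  finally show ?thesis by simp
qed

text \<open>An adjacent pair of hanging vertices is charged to the one farther from \<open>v 0\<close>.\<close>

lemma sum_adjacent_hanging_le:
  "(\<Sum>x\<in>hanging. \<Sum>y\<in>hanging. of_bool (gdist G x y = 1))
     \<le> 2 * (\<Sum>y\<in>hanging. of_bool (2 \<le> height y) :: real)"
proof -
  let ?D = "gdist G (v 0)"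
  let ?up = "\<lambda>x y. of_bool (gdist G x y = 1 \<and> ?D x < ?D y) :: real"
  have v0: "v 0 \<in> pverts G" using path_verts by simp
  have "(\<Sum>x\<in>hanging. \<Sum>y\<in>hanging. of_bool (gdist G x y = 1) :: real)
      = (\<Sum>x\<in>hanging. \<Sum>y\<in>hanging. ?up x y + ?up y x)"
  proof (intro sum.cong refl)
    fix x y assume "x \<in> hanging" "y \<in> hanging"
    then have "gdist G x y = 1 \<Longrightarrow> ?D x \<noteq> ?D y"
      using gdist_eq_1_iff gdist_neq_of_arc[OF v0] hangingD by blast
    then show "of_bool (gdist G x y = 1) = ?up x y + ?up y x"
      by (auto simp: gdist_sym)
  qed
  also have "\<dots> = (\<Sum>x\<in>hanging. \<Sum>y\<in>hanging. ?up x y) + (\<Sum>x\<in>hanging. \<Sum>y\<in>hanging. ?up y x)"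
    by (simp only: sum.distrib)
  \<comment> \<open>After the swap both summands are the same up to the names of bound variables,
    which yields the factor 2.\<close>
  also have "(\<Sum>x\<in>hanging. \<Sum>y\<in>hanging. ?up x y) = (\<Sum>y\<in>hanging. \<Sum>x\<in>hanging. ?up x y)"
    by (rule sum.swap)
  also have "\<dots> + \<dots> = 2 * \<dots>" by simp
  also have "\<dots> \<le> 2 * (\<Sum>y\<in>hanging. of_bool (2 \<le> height y))"
  proof (intro mult_left_mono sum_mono)
    fix y assume y: "y \<in> hanging"
    let ?P = "{x \<in> hanging. gdist G x y = 1 \<and> ?D x < ?D y}"
    have yV: "y \<in> pverts G" using y by (rule hangingD)
    have unique: "x = z" if "(x, y) \<in> parcs G" "?D x < ?D y" "(z, y) \<in> parcs G" "?D z < ?D y" for x z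
      using unique_lower_neighbour[OF v0] that by simp
    have arc: "(x, y) \<in> parcs G" if "x \<in> ?P" for x
      using that gdist_eq_1_iff[of x y] yV hangingD by auto
    have "(\<Sum>x\<in>hanging. ?up x y) = real (card ?P)"
      by (simp add: of_bool_def sum.If_cases Int_def)
    also have "\<dots> \<le> of_bool (2 \<le> height y)"
    proof (cases "2 \<le> height y")
      case True
      \<comment> \<open>A vertex has at most one neighbour nearer to \<open>v 0\<close>, so it is
        charged at most once.\<close>
      have "\<forall>x\<in>?P. \<forall>z\<in>?P. x = z" using unique arc by blast
      then have "card ?P \<le> Suc 0" by (subst card_le_Suc0_iff_eq) auto
      then show ?thesis using True by simp
    next
      case False
      \<comment> \<open>At height 1 the only neighbour nearer to \<open>v 0\<close> is the gate,
        which lies on the path, so \<open>y\<close> is charged nothing.\<close>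
      then have "height y = 1" using height_pos[OF y] by simp
      then have "gdist G y (v (gate y)) = 1" "?D y = Suc (?D (v (gate y)))"
        using gdist_path[OF yV, of 0] path_gdist[of 0 "gate y"] gate_le[OF yV]
        by (auto simp: height_def gdist_sym)
      then have "(v (gate y), y) \<in> parcs G" "?D (v (gate y)) < ?D y"
        using gdist_eq_1_iff[of "v (gate y)" y] yV path_verts gate_le[OF yV] by (auto simp: gdist_sym)
      then have "x = v (gate y)" if "x \<in> ?P" for x using unique arc that by blast
      moreover have "v (gate y) \<notin> hanging" using gate_le[OF yV] by (auto simp: hanging_def)
      ultimately have "?P = {}" by blast
      then show ?thesis by (simp only: card.empty) simp
    qed
    finally show "(\<Sum>x\<in>hanging. ?up x y) \<le> of_bool (2 \<le> height y)" .
  qed simp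
  finally show ?thesis .
qed

end

section \<open>The upper bound and its equality case\<close>

text \<open>Twice the index, counted over ordered pairs, when \<open>m\<close> vertices hang at
  height 1 from a centre of the path and are pairwise at distance 2.\<close>

definition harary_bound :: "nat \<Rightarrow> nat \<Rightarrow> real" where
  "harary_bound d m = (\<Sum>j\<le>d. spine_sum d j 0) + 2 * (real m * spine_sum d (d div 2) 1)
     + real m * (real m - 1) / 2"

context tree_with_path
begin

text \<open>The caterpillar described by distances alone. Together with the path and the number of
  hanging vertices this fixes every distance, hence the tree up to isomorphism.\<close>

definition broom_at :: "nat \<Rightarrow> bool" where
  "broom_at c \<longleftrightarrow> c \<le> d \<and> (\<forall>x\<in>hanging. \<forall>i\<le>d. gdist G x (v i) = Suc ((i - c) + (c - i)))
     \<and> (\<forall>x\<in>hanging. \<forall>y\<in>hanging. x \<noteq> y \<longrightarrow> gdist G x y = 2)"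

lemma sum_distinct_hanging:
  "(\<Sum>x\<in>hanging. \<Sum>y\<in>hanging. of_bool (x \<noteq> y) / 2 :: real)
     = real (card hanging) * (real (card hanging) - 1) / 2"
proof -
  have "(\<Sum>y\<in>hanging. of_bool (x \<noteq> y) / 2 :: real) = (real (card hanging) - 1) / 2" if "x \<in> hanging" for x
  proof -
    have "(\<Sum>y\<in>hanging. of_bool (x \<noteq> y) / 2 :: real) = (\<Sum>y\<in>hanging - {x}. 1 / 2)"
      by (rule sum.mono_neutral_cong_right) auto
    moreover have "0 < card hanging" using that by (auto simp: card_gt_0_iff)
    ultimately show ?thesis using that by (simp add: card_Diff_singleton of_nat_diff)
  qed
  then have "(\<Sum>x\<in>hanging. \<Sum>y\<in>hanging. of_bool (x \<noteq> y) / 2 :: real)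
      = (\<Sum>x\<in>hanging. (real (card hanging) - 1) / 2)"
    by (intro sum.cong refl)
  then show ?thesis by simp
qed

text \<open>Distance 2 is the baseline 1/2 for distinct vertices; only adjacent pairs exceed it, by
  exactly 1/2. On the diagonal both sides are 0.\<close>

lemma inverse_gdist_le:
  assumes "x \<in> hanging" "y \<in> hanging"
  shows "1 / real (gdist G x y) \<le> of_bool (x \<noteq> y) / 2 + of_bool (gdist G x y = 1) / 2"
proof -
  consider "x = y" | "x \<noteq> y" "gdist G x y = 1" | "x \<noteq> y" "2 \<le> gdist G x y"
    using gdist_eq_0_iff[of x y] hangingD assms by fastforce
  then show ?thesis
  proof cases
    case 3
    then have "1 / real (gdist G x y) \<le> 1 / 2" by (intro divide_left_mono) auto
    then show ?thesis using 3 by simp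
  qed (use assms hangingD in auto)
qed

text \<open>The extra 1/2 is the allowance a vertex of height at least 2 pays for the adjacent pair
  charged to it. By \<open>spine_sum_height\<close> its loss is strictly larger, so equality leaves
  only height 1, and then only a centre as gate.\<close>

lemma spine_sum_hanging:
  assumes "x \<in> hanging"
  shows spine_sum_hanging_le:
      "spine_sum d (gate x) (height x) + of_bool (2 \<le> height x) / 2 \<le> spine_sum d (d div 2) 1"
    and spine_sum_hanging_eqD:
      "spine_sum d (gate x) (height x) + of_bool (2 \<le> height x) / 2 = spine_sum d (d div 2) 1
        \<Longrightarrow> height x = 1 \<and> (gate x = d div 2 \<or> gate x = d - d div 2)"
proof -
  have g: "gate x \<le> d" by (rule gate_le) (rule hangingD[OF assms])
  have "height x = 1 \<or> 2 \<le> height x" using height_pos[OF assms] by linarith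
  then have "spine_sum d (gate x) (height x) + of_bool (2 \<le> height x) / 2 \<le> spine_sum d (d div 2) 1
    \<and> (spine_sum d (gate x) (height x) + of_bool (2 \<le> height x) / 2 = spine_sum d (d div 2) 1
        \<longrightarrow> height x = 1 \<and> (gate x = d div 2 \<or> gate x = d - d div 2))"
  proof
    assume "height x = 1"
    then show ?thesis using spine_sum_le_centre[OF g] spine_sum_less_centre[OF g] by fastforce
  next
    assume h: "2 \<le> height x"
    then show ?thesis using spine_sum_height[OF g d_pos h] spine_sum_le_centre[OF g] by simp
  qed
  then show
    "spine_sum d (gate x) (height x) + of_bool (2 \<le> height x) / 2 \<le> spine_sum d (d div 2) 1"
    "spine_sum d (gate x) (height x) + of_bool (2 \<le> height x) / 2 = spine_sum d (d div 2) 1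
        \<Longrightarrow> height x = 1 \<and> (gate x = d div 2 \<or> gate x = d - d div 2)"
    by blast+
qed

text \<open>This excludes, for odd \<open>d\<close>, hanging vertices spread over both centres. The
  middle vertex between \<open>x\<close> and \<open>y\<close> is adjacent to a hanging vertex, so it
  lies on the path; being at distance 1 from both, it is the gate of both.\<close>

lemma common_gate:
  assumes "\<And>x. x \<in> hanging \<Longrightarrow> height x = 1"
    and "\<And>x y. x \<in> hanging \<Longrightarrow> y \<in> hanging \<Longrightarrow> x \<noteq> y \<Longrightarrow> gdist G x y = 2"
    and "x \<in> hanging" "y \<in> hanging"
  shows "gate x = gate y"
proof (cases "x = y")
  case False
  have xy: "x \<in> pverts G" "y \<in> pverts G" using assms hangingD by auto
  then obtain z where z: "(z, y) \<in> parcs G" "gdist G x y = Suc (gdist G x z)"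
    using obtain_predecessor False by blast
  then have zV: "z \<in> pverts G" and zy: "z \<noteq> y" "gdist G y z = 1" and zx: "gdist G x z = 1"
    using in_arcsD1 no_loops' gdist_eq_1_iff[of z y] xy assms(2)[OF assms(3,4) False]
    by (auto simp: gdist_sym)
  have "z \<notin> hanging" using assms(2)[OF assms(4), of z] zy by auto
  then obtain i where "i \<le> d" "z = v i" using zV by (auto simp: hanging_def)
  then show ?thesis using gdist_path[OF xy(1), of i] gdist_path[OF xy(2), of i] zx zy assms(1,3,4) by simp
qed simp

text \<open>Each hanging vertex satisfies \<open>?f + ?h \<le> ?M\<close>, and each ordered pair
  contributes at most \<open>?e + ?a\<close>. The surplus \<open>?a\<close> sums to at most twice
  the sum of \<open>?h\<close>, which the factor 2 before the sum of \<open>?f\<close>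
  absorbs.\<close>

lemma
  shows harary_index_le_bound: "2 * harary_index G \<le> harary_bound d (card hanging)"
    and harary_index_eq_boundD: "2 * harary_index G = harary_bound d (card hanging)
      \<Longrightarrow> broom_at (d div 2) \<or> broom_at (d - d div 2)"
proof -
  let ?m = "real (card hanging)" and ?M = "spine_sum d (d div 2) 1"
  let ?f = "\<lambda>x. spine_sum d (gate x) (height x)"
  let ?h = "\<lambda>x. of_bool (2 \<le> height x) / 2 :: real"
  let ?e = "\<lambda>x y. of_bool (x \<noteq> y) / 2 :: real"
  let ?a = "\<lambda>x y. of_bool (gdist G x y = 1) / 2 :: real"
  let ?r = "\<lambda>x y. 1 / real (gdist G x y)"
  have fh: "(\<Sum>x\<in>hanging. ?f x + ?h x) \<le> (\<Sum>x\<in>hanging. ?M)"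
    by (intro sum_mono spine_sum_hanging_le)
  have rea: "(\<Sum>x\<in>hanging. \<Sum>y\<in>hanging. ?r x y) \<le> (\<Sum>x\<in>hanging. \<Sum>y\<in>hanging. ?e x y + ?a x y)"
    by (intro sum_mono inverse_gdist_le)
  have ah: "(\<Sum>x\<in>hanging. \<Sum>y\<in>hanging. ?a x y) \<le> 2 * (\<Sum>x\<in>hanging. ?h x)"
    using sum_adjacent_hanging_le by (simp only: sum_divide_distrib[symmetric])
  have ea: "(\<Sum>x\<in>hanging. \<Sum>y\<in>hanging. ?e x y + ?a x y)
      = ?m * (?m - 1) / 2 + (\<Sum>x\<in>hanging. \<Sum>y\<in>hanging. ?a x y)"
    by (simp only: sum.distrib sum_distinct_hanging)
  have fh': "(\<Sum>x\<in>hanging. ?f x + ?h x) = (\<Sum>x\<in>hanging. ?f x) + (\<Sum>x\<in>hanging. ?h x)"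
    "(\<Sum>x\<in>hanging. ?M) = ?m * ?M"
    by (simp_all add: sum.distrib)
  show "2 * harary_index G \<le> harary_bound d (card hanging)"
    unfolding harary_index_eq harary_bound_def using fh rea ah ea fh' by linarith
  assume eq: "2 * harary_index G = harary_bound d (card hanging)"
  \<comment> \<open>The bound is a sum of these inequalities, so equality of the totals makes each
    of them tight; below, tightness is passed on to the single terms.\<close>
  have fh_eq: "(\<Sum>x\<in>hanging. ?f x + ?h x) = (\<Sum>x\<in>hanging. ?M)"
    and rea_eq: "(\<Sum>x\<in>hanging. \<Sum>y\<in>hanging. ?r x y) = (\<Sum>x\<in>hanging. \<Sum>y\<in>hanging. ?e x y + ?a x y)"
    using eq fh rea ah ea fh' unfolding harary_index_eq harary_bound_def by linarith+
  have "?f x + ?h x = ?M" if "x \<in> hanging" for x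
    by (rule sum_mono_inv[OF fh_eq spine_sum_hanging_le that]) simp_all
  then have gh: "height x = 1" "gate x = d div 2 \<or> gate x = d - d div 2" if "x \<in> hanging" for x
    using spine_sum_hanging_eqD[OF that] that by blast+
  \<comment> \<open>With all heights equal to 1 there is nothing to charge adjacent pairs to, so
    there are none.\<close>
  have "(\<Sum>x\<in>hanging. \<Sum>y\<in>hanging. ?a x y) \<le> 0" using ah gh(1) by simp
  then have "(\<Sum>x\<in>hanging. \<Sum>y\<in>hanging. ?a x y) = 0"
    by (intro antisym sum_nonneg) auto
  then have nonadj: "gdist G x y \<noteq> 1" if "x \<in> hanging" "y \<in> hanging" for x y
    using that by (simp add: sum_nonneg_eq_0_iff sum_nonneg)
  have "(\<Sum>y\<in>hanging. ?r x y) = (\<Sum>y\<in>hanging. ?e x y + ?a x y)" if "x \<in> hanging" for x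
    by (rule sum_mono_inv[OF rea_eq sum_mono[OF inverse_gdist_le] that]) simp_all
  then have "?r x y = ?e x y + ?a x y" if "x \<in> hanging" "y \<in> hanging" for x y
    by (rule sum_mono_inv[OF _ inverse_gdist_le[OF that(1)] that(2)]) (use that in simp_all)
  then have dist2: "gdist G x y = 2" if "x \<in> hanging" "y \<in> hanging" "x \<noteq> y" for x y
    using nonadj[OF that(1,2)] that by (fastforce simp: field_simps)
  have broom: "broom_at c" if "c \<le> d" "\<And>x. x \<in> hanging \<Longrightarrow> gate x = c" for c
    unfolding broom_at_def using that gdist_path hangingD gh(1) dist2 by simp
  show "broom_at (d div 2) \<or> broom_at (d - d div 2)"
  \<comment> \<open>If nothing hangs off the path, any index serves as centre; otherwise the gate of
    one hanging vertex is the gate of all.\<close>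
  proof (cases "hanging = {}")
    case True
    then show ?thesis using broom[of "d div 2"] by simp
  next
    case False
    then obtain x where x: "x \<in> hanging" by blast
    have "broom_at (gate x)"
    proof (rule broom)
      show "gate x \<le> d" by (rule gate_le) (rule hangingD[OF x])
      show "gate y = gate x" if "y \<in> hanging" for y
        by (rule common_gate[OF gh(1) dist2 that x])
    qed
    then show ?thesis using gh(2)[OF x] by auto
  qed
qed

lemma broom_at_harary_index:
  assumes "broom_at (d div 2)"
  shows "2 * harary_index G = harary_bound d (card hanging)"
proof -
  have g: "gate x = d div 2" "height x = 1" if "x \<in> hanging" for x
  proof -
    have *: "Suc ((i - d div 2) + (d div 2 - i)) = height x + ((i - gate x) + (gate x - i))" if "i \<le> d" for i
      using assms gdist_path[of x i] hangingD \<open>x \<in> hanging\<close> that unfolding broom_at_def by simp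
    have "0 < height x" using that by (rule height_pos)
    moreover have "gate x \<le> d" using that by (intro gate_le hangingD)
    \<comment> \<open>At \<open>i = d div 2\<close> the identity reads 1 = height plus distance
      along the path to the gate, and the height is positive.\<close>
    ultimately show "gate x = d div 2" "height x = 1" using *[of "d div 2"] by auto
  qed
  have "1 / real (gdist G x y) = of_bool (x \<noteq> y) / 2" if "x \<in> hanging" "y \<in> hanging" for x y
    using assms that hangingD[of x] unfolding broom_at_def by (cases "x = y") auto
  then have "(\<Sum>x\<in>hanging. \<Sum>y\<in>hanging. 1 / real (gdist G x y))
      = (\<Sum>x\<in>hanging. \<Sum>y\<in>hanging. of_bool (x \<noteq> y) / 2)"
    by (intro sum.cong refl)
  then show ?thesis
    unfolding harary_index_eq harary_bound_def by (simp add: g sum_distinct_hanging)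
qed

end

section \<open>Isomorphisms\<close>

text \<open>A digraph isomorphism carries separate maps for vertices, arcs, heads and tails. As arcs
  are pairs here, the vertex map \<open>f\<close> determines the others.\<close>

lemma pair_digraph_isoI:
  assumes "pair_wf_digraph G" "bij_betw f (pverts G) (pverts H)" "pair_wf_digraph H"
    and arcs: "\<And>x y. x \<in> pverts G \<Longrightarrow> y \<in> pverts G \<Longrightarrow> (f x, f y) \<in> parcs H \<longleftrightarrow> (x, y) \<in> parcs G"
  shows "digraph_iso (with_proj G) (with_proj H)"
proof -
  interpret G: pair_wf_digraph G by fact
  interpret H: pair_wf_digraph H by fact
  let ?hom = "\<lparr>iso_verts = f, iso_arcs = map_prod f f, iso_head = snd, iso_tail = fst\<rparr>"
  have inj: "inj_on f (pverts G)" and im: "f ` pverts G = pverts H"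
    using assms(2) by (auto simp: bij_betw_def)
  have "parcs G \<subseteq> pverts G \<times> pverts G" using G.wellformed' by auto
  then have "inj_on (map_prod f f) (parcs G)"
    using map_prod_inj_on[OF inj inj] inj_on_subset by blast
  then have hom: "G.digraph_isomorphism ?hom"
    unfolding G.digraph_isomorphism_def using inj G.wf_digraph by auto
  have "map_prod f f ` parcs G = parcs H"
  proof (intro subset_antisym subsetI)
    fix e assume "e \<in> parcs H"
    then obtain x y where "x \<in> pverts G" "y \<in> pverts G" "e = (f x, f y)"
      using H.wellformed' im by (metis imageE surj_pair)
    then show "e \<in> map_prod f f ` parcs G"
      using \<open>e \<in> parcs H\<close> arcs by force
  qed (use arcs G.wellformed' in auto)
  then have "with_proj H = app_iso ?hom (with_proj G)"
    using im by (simp add: app_iso_def with_proj_def)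
  then show ?thesis unfolding digraph_iso_def using hom by blast
qed

lemma pair_digraph_isoE:
  assumes "pair_wf_digraph G" "digraph_iso (with_proj G) (with_proj H)"
  obtains f where "bij_betw f (pverts G) (pverts H)" "parcs H = map_prod f f ` parcs G"
proof -
  interpret G: pair_wf_digraph G by fact
  obtain hom where hom: "G.digraph_isomorphism hom" "with_proj H = app_iso hom (with_proj G)"
    using assms(2) unfolding digraph_iso_def by blast
  have "parcs H = map_prod (iso_verts hom) (iso_verts hom) ` parcs G"
    using G.arcs_ends_app_iso_eq[OF hom(1)] hom(2)[symmetric] by (simp add: map_prod_def)
  moreover have "pverts H = iso_verts hom ` pverts G"
    using arg_cong[OF hom(2), of verts] by simp
  ultimately show ?thesis
    using that[of "iso_verts hom"] hom(1) by (auto simp: G.digraph_isomorphism_def bij_betw_def)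
qed

text \<open>The image of a shortest walk is a walk of the same length.\<close>

lemma gdist_hom_le:
  assumes "connected_pair_graph G" "connected_pair_graph H"
    and "\<And>x. x \<in> pverts G \<Longrightarrow> f x \<in> pverts H" "\<And>x y. (x, y) \<in> parcs G \<Longrightarrow> (f x, f y) \<in> parcs H"
    and "x \<in> pverts G" "y \<in> pverts G"
  shows "gdist H (f x) (f y) \<le> gdist G x y"
proof -
  interpret G: connected_pair_graph G by fact
  interpret H: connected_pair_graph H by fact
  obtain p where p: "G.awalk x p y" "length p = gdist G x y" using G.gdist_awalk assms by blast
  have "H.awalk (f x) (map (map_prod f f) p) (f y)"
    using p(1) by (induction p arbitrary: x) (auto simp: G.awalk_simps H.awalk_simps assms(3,4))
  then show ?thesis using H.gdist_le_awalk p(2) by fastforce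
qed

text \<open>The vertex bijection and its inverse are both homomorphisms, so neither increases
  distances and both preserve them. The sums over ordered pairs then correspond term by
  term.\<close>

lemma harary_index_iso:
  assumes "connected_pair_graph G" "connected_pair_graph H" "digraph_iso (with_proj G) (with_proj H)"
  shows "harary_index G = harary_index H"
proof -
  interpret G: connected_pair_graph G by fact
  interpret H: connected_pair_graph H by fact
  obtain f where f: "bij_betw f (pverts G) (pverts H)" "parcs H = map_prod f f ` parcs G"
    using pair_digraph_isoE[OF _ assms(3)] G.pair_wf_digraph by blast
  let ?g = "the_inv_into (pverts G) f"
  have inj: "inj_on f (pverts G)" and im: "\<And>x. x \<in> pverts G \<Longrightarrow> f x \<in> pverts H"
    using f(1) by (auto simp: bij_betw_def)
  have gf: "?g (f x) = x" if "x \<in> pverts G" for x by (rule the_inv_into_f_f[OF inj that])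
  have gH: "?g y \<in> pverts G" if "y \<in> pverts H" for y
    using that f(1) by (intro the_inv_into_into[OF inj]) (auto simp: bij_betw_def)
  have gdist: "gdist H (f x) (f y) = gdist G x y" if xy: "x \<in> pverts G" "y \<in> pverts G" for x y
  proof (rule antisym)
    show "gdist H (f x) (f y) \<le> gdist G x y"
    proof (rule gdist_hom_le[OF assms(1,2) im _ xy])
      show "(f a, f b) \<in> parcs H" if "(a, b) \<in> parcs G" for a b
        using that unfolding f(2) by (rule map_prod_imageI)
    qed
    have "gdist G (?g (f x)) (?g (f y)) \<le> gdist H (f x) (f y)"
    proof (rule gdist_hom_le[OF assms(2,1) gH])
      show "(?g a, ?g b) \<in> parcs G" if "(a, b) \<in> parcs H" for a b
        using that f(2) gf G.in_arcsD1 G.in_arcsD2 by auto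
    qed (use im xy in auto)
    then show "gdist G x y \<le> gdist H (f x) (f y)" using gf xy by simp
  qed
  have fg: "f (?g y) = y" if "y \<in> pverts H" for y
    using that f(1) by (intro f_the_inv_into_f[OF inj]) (auto simp: bij_betw_def)
  have gdist': "gdist G (?g a) (?g b) = gdist H a b" if "a \<in> pverts H" "b \<in> pverts H" for a b
    using gdist[of "?g a" "?g b"] that fg gH by simp
  have g_inj: "?g a = ?g b \<longleftrightarrow> a = b" if "a \<in> pverts H" "b \<in> pverts H" for a b
    using fg that by metis
  let ?P = "\<lambda>V. {(x, y). x \<in> V \<and> y \<in> V \<and> x \<noteq> y}"
  have "(\<Sum>(x, y)\<in>?P (pverts H). 1 / real (gdist H x y))
      = (\<Sum>(x, y)\<in>?P (pverts G). 1 / real (gdist G x y))"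
  proof (rule sum.reindex_bij_witness[where i = "map_prod f f" and j = "map_prod ?g ?g"])
  qed (auto simp: gf gH im fg gdist' g_inj inj_on_eq_iff[OF inj])
  then show ?thesis
    by (simp add: harary_index_altdef[OF G.pair_graph] harary_index_altdef[OF H.pair_graph])
qed

section \<open>The caterpillar\<close>

text \<open>The last vertex of a cycle in the order given by \<open>f\<close> would have two lower neighbours.\<close>

lemma (in pair_graph) no_cycle_if_ordering:
  fixes f :: "'a \<Rightarrow> nat"
  assumes "\<And>a b y. (a, y) \<in> parcs G \<Longrightarrow> (b, y) \<in> parcs G \<Longrightarrow> f a \<le> f y \<Longrightarrow> f b \<le> f y \<Longrightarrow> a = b"
  shows "\<not> (\<exists>p. cycle p \<and> 3 \<le> length p)"
proof (intro notI, elim exE conjE)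
  fix p assume p: "cycle p" "3 \<le> length p"
  then obtain u where u: "awalk u p u" "distinct (tl (awalk_verts u p))" "p \<noteq> []"
    unfolding cycle_def by blast
  let ?k = "length p"
  have cas: "pcas u p u" using u(1) by (simp add: awalk_def)
  have last: "snd (last p) = u"
    using awlast_of_awalk[OF u(1)] u(3) by (simp add: awalk_verts_conv NOMATCH_def)
  have "awalk_verts u p = u # map snd p"
    using awalk_verts_conv'[OF cas] cas u(3) by (cases p) auto
  \<comment> \<open>The vertex sequence is read once through the tails and once through the heads;
    comparing entries shows that consecutive arcs meet.\<close>
  then have eq: "map fst p @ [snd (last p)] = u # map snd p"
    using awalk_verts_conv[of u p] u(3) by simp
  then have "(map fst p @ [snd (last p)]) ! j = (u # map snd p) ! j" for j by simp
  then have fst_Suc: "fst (p ! Suc j) = snd (p ! j)" if "Suc j < ?k" for j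
    using that by (metis (no_types, lifting) Suc_lessD length_map nth_Cons_Suc nth_append nth_map)
  have fst_0: "fst (p ! 0) = snd (p ! (?k - 1))"
  proof -
    have "fst (p ! 0) = u" using cas u(3) by (cases p) auto
    then show ?thesis using last u(3) by (simp add: last_conv_nth)
  qed
  have dist: "distinct (map snd p)"
    using u(2) \<open>awalk_verts u p = _\<close> by simp
  obtain j where j: "j < ?k" "\<And>l. l < ?k \<Longrightarrow> f (snd (p ! l)) \<le> f (snd (p ! j))"
  proof -
    let ?F = "(\<lambda>l. f (snd (p ! l))) ` {..<?k}"
    have "Max ?F \<in> ?F" using u(3) by (intro Max_in) (auto simp: lessThan_empty_iff bot_nat_def)
    then obtain j where j: "j < ?k" "Max ?F = f (snd (p ! j))" by auto
    have "f (snd (p ! l)) \<le> Max ?F" if "l < ?k" for l using that by (intro Max_ge) auto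
    then show ?thesis using j by (intro that[of j]) simp_all
  qed
  \<comment> \<open>The vertices of the cycle are numbered by the heads \<open>snd (p ! l)\<close>;
    \<open>pr\<close> and \<open>nx\<close> are the cyclic neighbours of the maximal index
    \<open>j\<close>. They differ because the cycle has at least three arcs.\<close>
  define pr where "pr = (if j = 0 then ?k - 1 else j - 1)"
  define nx where "nx = (if Suc j = ?k then 0 else Suc j)"
  have bounds: "pr < ?k" "nx < ?k" "pr \<noteq> nx" using j(1) p(2) by (auto simp: pr_def nx_def)
  have "fst (p ! j) = snd (p ! pr)" using fst_Suc[of "j - 1"] fst_0 j(1) by (auto simp: pr_def)
  moreover have "fst (p ! nx) = snd (p ! j)"
  proof (cases "Suc j = ?k")
    case True
    then have "?k - 1 = j" by simp
    then show ?thesis using fst_0 True by (simp add: nx_def)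
  next
    case False
    then show ?thesis using fst_Suc[of j] j(1) by (simp add: nx_def)
  qed
  moreover have "p ! j \<in> parcs G" "p ! nx \<in> parcs G"
    using u(1) j(1) bounds by (auto simp: awalk_def)
  ultimately have "(snd (p ! pr), snd (p ! j)) \<in> parcs G" "(snd (p ! nx), snd (p ! j)) \<in> parcs G"
    using arcs_symmetric by (metis prod.collapse)+
  then have "snd (p ! pr) = snd (p ! nx)" by (rule assms) (use j(2) bounds in auto)
  then show False using dist bounds by (simp add: distinct_conv_nth)
qed

lemma parcs_caterpillar:
  "(a, b) \<in> parcs (caterpillar n d i) \<longleftrightarrow>
    a < d \<and> b = Suc a \<or> a = i \<and> d < b \<and> b < n \<or> b < d \<and> a = Suc b \<or> b = i \<and> d < a \<and> a < n"
  by (auto simp: caterpillar_def Let_def)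

lemma pverts_caterpillar [simp]: "pverts (caterpillar n d i) = {0..<n}"
  by (simp add: caterpillar_def Let_def)

context
  fixes n d i :: nat
  assumes nd: "0 < i" "i < d" "d < n"
begin

lemma pair_graph_caterpillar: "pair_graph (caterpillar n d i)"
proof
  let ?C = "caterpillar n d i"
  show verts: "fst e \<in> pverts ?C" "snd e \<in> pverts ?C" if "e \<in> parcs ?C" for e
    using that nd by (cases e; auto simp: parcs_caterpillar)+
  show "finite (parcs ?C)"
    by (rule finite_subset[of _ "pverts ?C \<times> pverts ?C"]) (use verts in \<open>auto simp del: pverts_caterpillar\<close>, simp)
  show "finite (pverts ?C)" by simp
  show "symmetric (with_proj ?C)" by (auto simp: symmetric_def sym_def parcs_caterpillar)
  show "fst e \<noteq> snd e" if "e \<in> parcs ?C" for e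
    using that nd by (cases e) (auto simp: parcs_caterpillar)
qed

text \<open>In the numbering of the vertices each one except 0 has exactly one smaller neighbour.
  Descending along it gives walks to 0, hence connectedness, and its uniqueness excludes
  cycles.\<close>

lemma tree_graph_caterpillar: "tree_graph (caterpillar n d i)"
proof -
  let ?C = "caterpillar n d i"
  interpret pair_graph ?C by (rule pair_graph_caterpillar)
  have walk: "\<exists>p. awalk 0 p x" if "x < n" for x
    using that
  proof (induction x rule: less_induct)
    case (less x)
    show ?case
    proof (cases "x = 0")
      case True
      then show ?thesis using less.prems by (intro exI[of _ "[]"]) (simp add: awalk_simps)
    next
      case False
      define z where "z = (if x \<le> d then x - 1 else i)"
      have z: "z < x" "(z, x) \<in> parcs ?C" using False nd less.prems by (auto simp: z_def parcs_caterpillar)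
      then obtain p where "awalk 0 p z" using less by auto
      then have "awalk 0 (p @ [(z, x)]) x"
        using z less.prems by (intro awalk_appendI[of 0 p z]) (auto simp: awalk_simps)
      then show ?thesis by blast
    qed
  qed
  have "\<exists>p. awalk x p y" if "x < n" "y < n" for x y
  proof -
    obtain p where "awalk 0 p x" using walk \<open>x < n\<close> by blast
    moreover obtain q where "awalk 0 q y" using walk \<open>y < n\<close> by blast
    ultimately have "awalk x (rev_path p @ q) y" by (intro awalk_appendI[of x _ 0]) auto
    then show ?thesis by blast
  qed
  then have "connected (with_proj ?C)"
    using nd by (intro connectedI reachable_mk_symmetricI) (auto simp: reachable_awalk)
  moreover have "\<not> (\<exists>p. cycle p \<and> 3 \<le> length p)"
    by (rule no_cycle_if_ordering[where f = id]) (use nd in \<open>auto simp: parcs_caterpillar\<close>)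
  ultimately show ?thesis by unfold_locales
qed

lemma tree_with_path_caterpillar: "tree_with_path (caterpillar n d i) (\<lambda>k. k) d"
proof -
  let ?C = "caterpillar n d i"
  interpret tree_graph ?C by (rule tree_graph_caterpillar)
  have le: "gdist ?C k l = l - k" if "k \<le> l" "l \<le> d" for k l
  proof (rule antisym)
    have "gdist ?C (k + 0) (k + (l - k)) \<le> l - k"
      by (rule gdist_chain_le) (use that nd in \<open>auto simp: parcs_caterpillar\<close>)
    then show "gdist ?C k l \<le> l - k" using that by simp
    \<comment> \<open>The potential projects the caterpillar onto its spine, sending pendent
      vertices to \<open>i\<close>; it changes by at most 1 along arcs.\<close>
    have "int l \<le> int k + int (gdist ?C l k)"
      using lipschitz_le_gdist[of "\<lambda>k. if k \<le> d then int k else int i" l k] that nd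
      by (fastforce simp: parcs_caterpillar)
    then show "l - k \<le> gdist ?C k l" by (simp add: gdist_sym)
  qed
  show ?thesis
  proof
    show "gdist ?C k l = (k - l) + (l - k)" if "k \<le> d" "l \<le> d" for k l
      using le[of k l] le[of l k] that gdist_sym[of k l] by (cases "k \<le> l") auto
  qed (use nd in auto)
qed

interpretation C: tree_with_path "caterpillar n d i" "\<lambda>k. k" d
  by (rule tree_with_path_caterpillar)

lemma hanging_caterpillar: "C.hanging = {d<..<n}"
  using nd by (auto simp: C.hanging_def)

lemma broom_at_caterpillar: "C.broom_at i"
  unfolding C.broom_at_def
proof (intro conjI ballI allI impI)
  let ?C = "caterpillar n d i"
  show "i \<le> d" using nd by simp
  have i1: "gdist ?C x i = 1" if "x \<in> C.hanging" for x
    using that nd C.gdist_eq_1_iff[of x i] by (simp add: hanging_caterpillar parcs_caterpillar)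
  fix x assume x: "x \<in> C.hanging"
  \<comment> \<open>Distance 1 to \<open>i\<close> together with positive height forces the gate to
    be \<open>i\<close> and the height to be 1.\<close>
  show "gdist ?C x k = Suc ((k - i) + (i - k))" if "k \<le> d" for k
    using C.gdist_path[OF C.hangingD[OF x], of i] C.gdist_path[OF C.hangingD[OF x] that]
      C.height_pos[OF x] i1[OF x] nd by auto
  fix y assume y: "y \<in> C.hanging" "x \<noteq> y"
  have "gdist ?C x y \<le> 2"
    using C.gdist_triangle[of x i y] i1[OF x] i1[OF y(1)] x y nd
    by (simp add: hanging_caterpillar C.gdist_sym)
  moreover have "gdist ?C x y \<noteq> 1" "gdist ?C x y \<noteq> 0"
    using C.gdist_eq_1_iff[of x y] C.gdist_eq_0_iff[of x y] x y nd
    by (auto simp: hanging_caterpillar parcs_caterpillar)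
  ultimately show "gdist ?C x y = 2" by linarith
qed

text \<open>That \<open>i\<close> is an inner vertex of the spine matters twice: a pendent vertex is
  then at most \<open>d\<close> away from each spine vertex, and \<open>d\<close> is at least 2, the
  distance of two pendent vertices.\<close>

lemma diameter_caterpillar: "diameter (caterpillar n d i) = d"
proof (rule antisym)
  let ?C = "caterpillar n d i"
  have le: "gdist ?C x k \<le> d" if "x < n" "k \<le> d" for x k
  proof (cases "x \<le> d")
    case True
    then show ?thesis using C.path_gdist that by simp
  next
    case False
    then show ?thesis using broom_at_caterpillar that nd by (auto simp: C.broom_at_def hanging_caterpillar)
  qed
  obtain x y where xy: "x < n" "y < n" "gdist ?C x y = diameter ?C"
    using C.obtain_diametral_pair by auto
  consider "y \<le> d" | "x \<le> d" | "x \<in> C.hanging" "y \<in> C.hanging" 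
    using xy by (force simp: hanging_caterpillar)
  then show "diameter ?C \<le> d"
  proof cases
    case 3
    then have "gdist ?C x y \<le> 2"
      using broom_at_caterpillar C.gdist_self[of x] xy(1) unfolding C.broom_at_def by (cases "x = y") auto
    then show ?thesis using xy nd by simp
  qed (use xy le C.gdist_sym in metis)+
  show "d \<le> diameter ?C" using C.gdist_le_diameter[of 0 d] C.path_gdist[of 0 d] nd by simp
qed

lemma caterpillar_in_trees_of_diameter: "caterpillar n d i \<in> trees_of_diameter n d"
  using C.connected C.no_cycle pair_graph_caterpillar diameter_caterpillar
  by (simp add: trees_of_diameter_def undirected_tree_def)

end

section \<open>Uniqueness of the extremal tree\<close>

lemma (in tree_with_path) tree_with_reversed_path: "tree_with_path G (\<lambda>i. v (d - i)) d"
proof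
  show "gdist G (v (d - i)) (v (d - j)) = (i - j) + (j - i)" if "i \<le> d" "j \<le> d" for i j
    using path_gdist[of "d - i" "d - j"] that by simp
qed (use d_pos path_verts in auto)

text \<open>For odd \<open>d\<close> the equality case may give the other centre
  \<open>d - d div 2\<close>; reversing the path turns it into \<open>d div 2\<close>.\<close>

lemma (in tree_with_path) broom_at_reversed:
  assumes "broom_at c"
  shows "tree_with_path.broom_at G (\<lambda>i. v (d - i)) d (d - c)"
proof -
  interpret R: tree_with_path G "\<lambda>i. v (d - i)" d by (rule tree_with_reversed_path)
  have "v j \<in> (\<lambda>i. v (d - i)) ` {..d}" if "j \<le> d" for j
    using that by (intro image_eqI[of _ _ "d - j"]) auto
  then have "(\<lambda>i. v (d - i)) ` {..d} = v ` {..d}" by auto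
  then have "R.hanging = hanging" by (simp add: R.hanging_def hanging_def)
  moreover have "gdist G x (v (d - i)) = Suc ((i - (d - c)) + ((d - c) - i))"
    if "x \<in> hanging" "i \<le> d" for x i
  proof -
    have "gdist G x (v (d - i)) = Suc (((d - i) - c) + (c - (d - i)))" and "c \<le> d"
      using assms that unfolding broom_at_def by auto
    then show ?thesis using that by simp
  qed
  ultimately show ?thesis using assms unfolding broom_at_def R.broom_at_def by simp
qed

text \<open>Map path to path in order and hanging vertices to hanging vertices by an arbitrary
  bijection. All distances agree, and arcs are the pairs at distance 1.\<close>

lemma broom_iso:
  assumes "tree_with_path G v d" "tree_with_path H w d" "card (pverts G) = card (pverts H)"
    and "tree_with_path.broom_at G v d c" "tree_with_path.broom_at H w d c"
  shows "digraph_iso (with_proj G) (with_proj H)"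
proof -
  interpret G: tree_with_path G v d by fact
  interpret H: tree_with_path H w d by fact
  have "card G.hanging = card H.hanging"
    using assms(3) by (simp add: G.card_hanging H.card_hanging)
  then obtain b where b: "bij_betw b G.hanging H.hanging"
    using finite_same_card_bij G.finite_hanging H.finite_hanging by blast
  define f where "f x = (if x \<in> G.hanging then b x else w (inv_into {..d} v x))" for x
  have fv: "f (v i) = w i" if "i \<le> d" for i
    using that inv_into_f_f[OF G.path_inj] by (simp add: f_def G.hanging_def)
  have fb: "f x = b x" if "x \<in> G.hanging" for x using that by (simp add: f_def)
  have bH: "b x \<in> H.hanging" if "x \<in> G.hanging" for x using b that by (auto simp: bij_betw_def)
  have "bij_betw f (v ` {..d}) (w ` {..d})"
    unfolding bij_betw_def inj_on_def using fv inj_on_eq_iff[OF H.path_inj] by force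
  moreover have "bij_betw f G.hanging H.hanging"
    using b fb by (simp cong: bij_betw_cong)
  ultimately have bij: "bij_betw f (pverts G) (pverts H)"
    unfolding G.verts_decomp(1) H.verts_decomp(1) using H.verts_decomp(2) by (intro bij_betw_combine)
  have mixed: "gdist H (b x) (w i) = gdist G x (v i)" if "x \<in> G.hanging" "i \<le> d" for x i
    using assms(4,5) that bH unfolding G.broom_at_def H.broom_at_def by simp
  have off: "gdist H (b x) (b y) = gdist G x y" if xy: "x \<in> G.hanging" "y \<in> G.hanging" for x y
  proof (cases "x = y")
    case True
    then show ?thesis using xy bH G.hangingD H.hangingD by simp
  next
    case False
    then have "b x \<noteq> b y" using b xy by (auto simp: bij_betw_def inj_on_def)
    then show ?thesis using assms(4,5) xy False bH unfolding G.broom_at_def H.broom_at_def by simp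
  qed
  have gdist: "gdist H (f x) (f y) = gdist G x y" if xy: "x \<in> pverts G" "y \<in> pverts G" for x y
  proof -
    consider i j where "x = v i" "y = v j" "i \<le> d" "j \<le> d" | i where "x = v i" "i \<le> d" "y \<in> G.hanging"
      | i where "x \<in> G.hanging" "y = v i" "i \<le> d" | "x \<in> G.hanging" "y \<in> G.hanging"
      using xy unfolding G.verts_decomp(1) by blast
    then show ?thesis
    proof cases
      case 1
      then show ?thesis by (simp add: fv G.path_gdist H.path_gdist)
    next
      case (2 i)
      then show ?thesis using mixed[of y i] by (simp add: fv fb G.gdist_sym H.gdist_sym)
    next
      case (3 i)
      then show ?thesis using mixed[of x i] by (simp add: fv fb)
    next
      case 4
      then show ?thesis using off by (simp add: fb)
    qed
  qed
  show ?thesis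
  proof (rule pair_digraph_isoI[OF G.pair_wf_digraph bij H.pair_wf_digraph])
    fix x y assume xy: "x \<in> pverts G" "y \<in> pverts G"
    then have "f x \<in> pverts H" "f y \<in> pverts H" using bij by (auto simp: bij_betw_def)
    then show "(f x, f y) \<in> parcs H \<longleftrightarrow> (x, y) \<in> parcs G"
      using gdist[OF xy] G.gdist_eq_1_iff[OF xy] H.gdist_eq_1_iff by metis
  qed
qed

theorem theorem3p7:
  fixes n d :: nat
  assumes "2 \<le> d" and "d \<le> n - 1"
  shows "caterpillar n d (d div 2) \<in> trees_of_diameter n d \<and>
    (\<forall>T :: 'a pair_pre_digraph. T \<in> trees_of_diameter n d \<longrightarrow>
       harary_index T \<le> harary_index (caterpillar n d (d div 2)) \<and>
       (harary_index T = harary_index (caterpillar n d (d div 2)) \<longleftrightarrow>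
          digraph_iso (with_proj T) (with_proj (caterpillar n d (d div 2)))))"
proof (intro conjI allI impI)
  let ?c = "d div 2"
  let ?C = "caterpillar n d ?c"
  have nd: "0 < ?c" "?c < d" "d < n" using assms by auto
  show "?C \<in> trees_of_diameter n d" using nd by (rule caterpillar_in_trees_of_diameter)
  interpret C: tree_with_path ?C "\<lambda>k. k" d using nd by (rule tree_with_path_caterpillar)
  have C_broom: "C.broom_at ?c" using nd by (rule broom_at_caterpillar)
  \<comment> \<open>The caterpillar attains the bound, which depends only on \<open>n\<close> and
    \<open>d\<close>.\<close>
  have C_bound: "2 * harary_index ?C = harary_bound d (n - Suc d)"
    using C.broom_at_harary_index[OF C_broom] by (simp add: C.card_hanging)
  fix T :: "'a pair_pre_digraph"
  assume "T \<in> trees_of_diameter n d"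
  then have T: "undirected_tree T" "card (pverts T) = n" "diameter T = d"
    by (auto simp: trees_of_diameter_def)
  interpret tree_graph T
    using T(1) unfolding undirected_tree_def tree_graph_def connected_pair_graph_def
      connected_pair_graph_axioms_def tree_graph_axioms_def by blast
  \<comment> \<open>A geodesic between a diametral pair is an isometric path with exactly
    \<open>d\<close> arcs, so \<open>T\<close> has as many hanging vertices as the caterpillar and
    is subject to the same bound.\<close>
  obtain x y where xy: "x \<in> pverts T" "y \<in> pverts T" "gdist T x y = d"
    using obtain_diametral_pair T(3) by metis
  obtain v where v: "\<And>i. i \<le> d \<Longrightarrow> v i \<in> pverts T"
    "\<And>i j. i \<le> d \<Longrightarrow> j \<le> d \<Longrightarrow> gdist T (v i) (v j) = (i - j) + (j - i)"
    using obtain_geodesic[OF xy(1,2)] unfolding xy(3) by blast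
  interpret P: tree_with_path T v d by unfold_locales (use v assms in auto)
  have card: "card P.hanging = n - Suc d" by (simp add: P.card_hanging T(2))
  show "harary_index T \<le> harary_index ?C"
    using P.harary_index_le_bound C_bound by (simp add: card)
  show "harary_index T = harary_index ?C \<longleftrightarrow> digraph_iso (with_proj T) (with_proj ?C)"
  proof
    assume "harary_index T = harary_index ?C"
    then have "P.broom_at ?c \<or> P.broom_at (d - ?c)"
      using P.harary_index_eq_boundD C_bound by (simp add: card)
    \<comment> \<open>\<open>w\<close> is \<open>v\<close> or its reversal, whichever has the broom
      at \<open>d div 2\<close>.\<close>
    then obtain w where "tree_with_path T w d" "tree_with_path.broom_at T w d ?c"
      using P.tree_with_path_axioms P.tree_with_reversed_path P.broom_at_reversed[of "d - ?c"] by fastforce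
    then show "digraph_iso (with_proj T) (with_proj ?C)"
      using C.tree_with_path_axioms C_broom T(2) by (intro broom_iso[of T w d ?C "\<lambda>k. k" ?c]) simp_all
  next
    assume "digraph_iso (with_proj T) (with_proj ?C)"
    then show "harary_index T = harary_index ?C"
      using connected_pair_graph_axioms C.connected_pair_graph_axioms by (intro harary_index_iso)
  qed
qed

end
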